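(* Let $R$ be a left distributive ring (not necessarily associative, unital or right distributive). Then $R[x]$ is left Noetherian if and only if $R$ is left Noetherian and weakly left $s$-unital. In particular, if $R$ is unital, then $R[x]$ is left Noetherian if and only if $R$ is left Noetherian.
   Context: Here a ring $R$ means an additive (abelian) group with an arbitrary map $R\times R\to R$, $(r,s)\mapsto rs$. $R$ is left distributive if $r(s+t)=rs+rt$ for all $r,s,t\in R$. It is assumed that $0\in R$ is a zero element for the multiplication action: $0r=0$ for all $r\in R$. A left ideal of $R$ is an additive subgroup $N$ with $rn\in N$ for all $r\in R$, $n\in N$; $R$ is left Noetherian if every ascending chain of left ideals stabilizes (same definition for $R[x]$). For $m\in R$ and $n\ge 1$, $R^n m$ is the set of all $r_1(r_2(\cdots(r_nm)\cdots))$ with $r_1,\ldots,r_n\in R$. $R$ is weakly left $s$-unital if each $m\in R$ lies in $\sum_{n\ge 1}\mathbb{Z}(R^nm)$, i.e. $m$ is a finite sum of integer multiples of elements of $\bigcup_{n\ge1}R^nm$. $R[x]$ is the group of polynomials $\sum_{i\ge 0}r_ix^i$ (finitely many nonzero coefficients in $R$) with coefficientwise addition and multiplication $\bigl(\sum_i r_ix^i\bigr)\bigl(\sum_j s_jx^j\bigr)=\sum_{i,j}(r_is_j)x^{i+j}$. *)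

theory Defs
  imports Complex_Main "HOL-Computational_Algebra.Polynomial"
begin

text \<open>
  A ring is the additive group of a type of class \<open>ab_group_add\<close> together with an explicit,
  arbitrary multiplication \<open>mul\<close>. The multiplication is passed as an argument because the
  instance of \<open>times\<close> for \<open>'a poly\<close> in the library is only available over commutative
  (associative) semirings, so it cannot serve as the multiplication of \<open>R[x]\<close> here.
\<close>

definition left_distributive_ring :: "('a::ab_group_add \<Rightarrow> 'a \<Rightarrow> 'a) \<Rightarrow> bool" where
  "left_distributive_ring mul \<longleftrightarrow>
     (\<forall>r. mul 0 r = 0) \<and> (\<forall>r s t. mul r (s + t) = mul r s + mul r t)"

definition unital :: "('a \<Rightarrow> 'a \<Rightarrow> 'a) \<Rightarrow> bool" where
  "unital mul \<longleftrightarrow> (\<exists>e. \<forall>r. mul e r = r \<and> mul r e = r)"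

definition left_ideal :: "('a::ab_group_add \<Rightarrow> 'a \<Rightarrow> 'a) \<Rightarrow> 'a set \<Rightarrow> bool" where
  "left_ideal mul N \<longleftrightarrow>
     0 \<in> N \<and> (\<forall>a\<in>N. \<forall>b\<in>N. a + b \<in> N) \<and> (\<forall>a\<in>N. - a \<in> N) \<and> (\<forall>r. \<forall>n\<in>N. mul r n \<in> N)"

definition left_noetherian :: "('a::ab_group_add \<Rightarrow> 'a \<Rightarrow> 'a) \<Rightarrow> bool" where
  "left_noetherian mul \<longleftrightarrow>
     (\<forall>I :: nat \<Rightarrow> 'a set. (\<forall>k. left_ideal mul (I k)) \<and> (\<forall>k. I k \<subseteq> I (Suc k)) \<longrightarrow>
        (\<exists>k. \<forall>l\<ge>k. I l = I k))"

text \<open>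
  The set \<open>R\<^sup>n m\<close>: \<open>foldr mul [r\<^sub>1, \<dots>, r\<^sub>n] m\<close> is the right-nested product
  \<open>r\<^sub>1 (r\<^sub>2 (\<dots> (r\<^sub>n m) \<dots>))\<close>.
\<close>

definition left_products :: "('a \<Rightarrow> 'a \<Rightarrow> 'a) \<Rightarrow> nat \<Rightarrow> 'a \<Rightarrow> 'a set" where
  "left_products mul n m = {foldr mul rs m | rs. length rs = n}"

definition int_multiple :: "int \<Rightarrow> 'a::ab_group_add \<Rightarrow> 'a" where
  "int_multiple k a = (if k \<ge> 0 then (\<Sum>i<nat k. a) else - (\<Sum>i<nat (- k). a))"

definition weakly_left_s_unital :: "('a::ab_group_add \<Rightarrow> 'a \<Rightarrow> 'a) \<Rightarrow> bool" where
  "weakly_left_s_unital mul \<longleftrightarrow>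
     (\<forall>m. \<exists>T c. finite T \<and> T \<subseteq> (\<Union>n\<in>{1..}. left_products mul n m) \<and>
        m = (\<Sum>s\<in>T. int_multiple (c s) s))"

text \<open>
  The multiplication of \<open>R[x]\<close>. Only indices up to the degrees are summed over; the other
  terms of \<open>\<Sum>\<^sub>i\<^sub>,\<^sub>j (r\<^sub>i s\<^sub>j) x\<^sup>i\<^sup>+\<^sup>j\<close> vanish as \<open>0 r = 0\<close> and, by left distributivity, \<open>r 0 = 0\<close>
  (see \<open>coeff_poly_mul\<close> below).
\<close>

definition poly_mul ::
    "('a::ab_group_add \<Rightarrow> 'a \<Rightarrow> 'a) \<Rightarrow> 'a poly \<Rightarrow> 'a poly \<Rightarrow> 'a poly" where
  "poly_mul mul p q =
     (\<Sum>i\<le>degree p. \<Sum>j\<le>degree q. monom (mul (coeff p i) (coeff q j)) (i + j))"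

lemma left_distributive_ring_zero:
  assumes "left_distributive_ring mul"
  shows "mul 0 r = 0" "mul r 0 = 0"
proof -
  show "mul 0 r = 0" using assms by (simp add: left_distributive_ring_def)
  have "mul r (0 + 0) = mul r 0 + mul r 0"
    using assms unfolding left_distributive_ring_def by blast
  then show "mul r 0 = 0" by simp
qed

lemma coeff_poly_mul:
  assumes "left_distributive_ring mul"
  shows "coeff (poly_mul mul p q) n = (\<Sum>i\<le>n. mul (coeff p i) (coeff q (n - i)))"
proof -
  have inner: "(\<Sum>j\<le>degree q. if i + j = n then mul (coeff p i) (coeff q j) else 0)
      = (if i \<le> n then mul (coeff p i) (coeff q (n - i)) else 0)" for i
  proof (cases "i \<le> n")
    case True
    then have "(\<Sum>j\<le>degree q. if i + j = n then mul (coeff p i) (coeff q j) else 0)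
      = (\<Sum>j\<le>degree q. if j = n - i then mul (coeff p i) (coeff q j) else 0)"
      by (intro sum.cong) auto
    also have "\<dots> = mul (coeff p i) (coeff q (n - i))"
      using left_distributive_ring_zero[OF assms] by (auto simp: coeff_eq_0)
    finally show ?thesis using True by simp
  qed (auto intro: sum.neutral)
  have "coeff (poly_mul mul p q) n =
      (\<Sum>i\<le>degree p. if i \<le> n then mul (coeff p i) (coeff q (n - i)) else 0)"
    by (simp add: poly_mul_def coeff_sum inner)
  also have "\<dots> = (\<Sum>i\<in>{..degree p} \<inter> {..n}. mul (coeff p i) (coeff q (n - i)))"
    by (subst sum.inter_restrict) auto
  also have "\<dots> = (\<Sum>i\<le>n. mul (coeff p i) (coeff q (n - i)))"
    using left_distributive_ring_zero[OF assms]
    by (intro sum.mono_neutral_left) (auto intro!: le_degree)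
  finally show ?thesis .
qed

end

theory Submission
  imports Defs
begin

text \<open>
  By left distributivity every \<open>r\<close> acts on \<open>R\<close> as an additive map, so left ideals are
  submodules for the ring of operators generated by these maps, and left ideals of \<open>R[x]\<close> are
  the additive subgroups stable under all operators \<open>x\<^sup>i r\<close>.

  Let \<open>Am\<close> be the additive group generated by all products \<open>r\<^sub>1 (\<dots> (r\<^sub>n m))\<close> with \<open>n \<ge> 1\<close>. If
  \<open>R[x]\<close> is left Noetherian, consider the polynomials whose coefficients are all mapped into
  \<open>Am\<close> by left multiplications and lie in \<open>Am\<close> beyond index \<open>k\<close>. These form an ascending chain
  of left ideals, and \<open>m x\<^sup>k\<^sup>+\<^sup>1\<close> belongs to the one of index \<open>k + 1\<close>; stabilization gives
  \<open>m \<in> Am\<close>.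

  Conversely, if \<open>m \<in> Am\<close> for all \<open>m\<close>, then Tominaga's argument for s-unital modules yields, for
  finitely many elements, one operator fixing them all. Applied to the coefficients of \<open>f\<close> it
  shows that left ideals of \<open>R[x]\<close> are closed under multiplication by \<open>x\<close>, although \<open>x\<close> need
  not be an element of \<open>R[x]\<close>, and then Hilbert's leading coefficient argument applies.
\<close>

section \<open>Integer multiples\<close>

lemma int_multiple_simps [simp]:
  "int_multiple 0 a = 0" "int_multiple 1 a = a" "int_multiple k 0 = 0"
  by (simp_all add: int_multiple_def)

lemma int_multiple_of_nat: "int_multiple (int n) a = (\<Sum>i<n. a)"
  by (simp add: int_multiple_def)

lemma int_multiple_minus: "int_multiple (- k) a = - int_multiple k a"
  by (cases "k = 0") (auto simp: int_multiple_def)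

lemma int_multiple_plus_one: "int_multiple (k + 1) a = int_multiple k a + a"
proof (cases "k \<ge> 0")
  case True
  then obtain n where "k = int n" by (metis nonneg_int_cases)
  then show ?thesis
    using int_multiple_of_nat[of "Suc n" a] by (simp add: int_multiple_of_nat add.commute)
next
  case False
  then obtain n where k: "k = - int (Suc n)"
    by (metis add.commute negD not_le of_nat_Suc)
  have "int_multiple k a = - (int_multiple (int n) a + a)"
    unfolding k int_multiple_minus int_multiple_of_nat by simp
  moreover have "int_multiple (k + 1) a = - int_multiple (int n) a"
    unfolding int_multiple_minus[symmetric] by (simp add: k)
  ultimately show ?thesis by simp
qed

lemma int_multiple_add_left: "int_multiple (k + l) a = int_multiple k a + int_multiple l a"
proof (induction l rule: int_induct[of _ 0])
  case (step1 i)
  then show ?case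
    by (metis add.assoc int_multiple_plus_one)
next
  case (step2 i)
  have "int_multiple (k + (i - 1)) a + a = int_multiple (k + i) a"
    unfolding int_multiple_plus_one[symmetric] by (simp add: algebra_simps)
  moreover have "int_multiple (i - 1) a + a = int_multiple i a"
    unfolding int_multiple_plus_one[symmetric] by simp
  ultimately show ?case
    using step2 by (metis add.assoc add_right_cancel)
qed simp

lemma int_multiple_add_right: "int_multiple k (a + b) = int_multiple k a + int_multiple k b"
  by (simp add: int_multiple_def sum.distrib)

lemma int_multiple_mult: "int_multiple (k * l) a = int_multiple k (int_multiple l a)"
proof (induction k rule: int_induct[of _ 0])
  case (step1 i)
  then show ?case
    by (simp add: distrib_right int_multiple_add_left)
next
  case (step2 i)
  then show ?case
    using int_multiple_add_left[of "i - 1" 1 "int_multiple l a"]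
      int_multiple_add_left[of "(i - 1) * l" l a]
    by (simp add: algebra_simps)
qed simp

text \<open>Over the integers, spans are generated subgroups, and span induction becomes available
  for them.\<close>

interpretation int_mod: module "int_multiple :: int \<Rightarrow> 'a::ab_group_add \<Rightarrow> 'a"
  by standard
    (simp_all add: int_multiple_add_left int_multiple_add_right int_multiple_mult)

lemma int_subspaceI:
  assumes "0 \<in> V" "\<And>a b. a \<in> V \<Longrightarrow> b \<in> V \<Longrightarrow> a + b \<in> V" "\<And>a. a \<in> V \<Longrightarrow> - a \<in> V"
  shows "int_mod.subspace V"
proof -
  have nat: "int_multiple (int n) a \<in> V" if "a \<in> V" for n a
    using that assms(1,2) unfolding int_multiple_of_nat by (induction n) auto
  have "int_multiple k a \<in> V" if "a \<in> V" for k a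
    using nat[OF that] assms(3) by (cases k) (metis int_multiple_minus)+
  then show ?thesis
    using assms by (auto simp: int_mod.subspace_def)
qed

definition left_span :: "('a::ab_group_add \<Rightarrow> 'a \<Rightarrow> 'a) \<Rightarrow> 'a \<Rightarrow> 'a set" where
  "left_span mul m = int_mod.span (\<Union>n\<in>{1..}. left_products mul n m)"

text \<open>The definition is the explicit description of a span by finite integer
  combinations.\<close>

lemma weakly_left_s_unital_iff: "weakly_left_s_unital mul \<longleftrightarrow> (\<forall>m. m \<in> left_span mul m)"
  unfolding weakly_left_s_unital_def left_span_def int_mod.span_explicit mem_Collect_eq
  by (simp only: conj_assoc conj_commute conj_left_commute)

lemma unital_imp_weakly_left_s_unital:
  assumes "unital mul"
  shows "weakly_left_s_unital mul"
proof -
  obtain e where e: "\<And>r. mul e r = r"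
    using assms by (auto simp: unital_def)
  have "m \<in> left_products mul 1 m" for m
    unfolding left_products_def using e by (auto intro!: exI[of _ "[e]"])
  then show ?thesis
    unfolding weakly_left_s_unital_iff left_span_def
    by (meson UN_I atLeast_iff int_mod.span_base order_refl)
qed

section \<open>Operators generated by left multiplications\<close>

text \<open>The identity is not put in, since the aim is to find operators that act like it on given
  elements. Differences also yield zero, negatives and sums.\<close>

inductive_set left_ops :: "('a::ab_group_add \<Rightarrow> 'a \<Rightarrow> 'a) \<Rightarrow> ('a \<Rightarrow> 'a) set"
  for mul :: "'a::ab_group_add \<Rightarrow> 'a \<Rightarrow> 'a" where
  mult: "mul r \<in> left_ops mul"
| comp: "\<phi> \<in> left_ops mul \<Longrightarrow> (\<lambda>a. mul r (\<phi> a)) \<in> left_ops mul"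
| diff: "\<phi> \<in> left_ops mul \<Longrightarrow> \<psi> \<in> left_ops mul \<Longrightarrow> (\<lambda>a. \<phi> a - \<psi> a) \<in> left_ops mul"

lemma left_idealD:
  assumes "left_ideal mul N"
  shows "0 \<in> N" "a \<in> N \<Longrightarrow> b \<in> N \<Longrightarrow> a + b \<in> N" "a \<in> N \<Longrightarrow> - a \<in> N" "a \<in> N \<Longrightarrow> mul r a \<in> N"
    "a \<in> N \<Longrightarrow> b \<in> N \<Longrightarrow> a - b \<in> N"
  using assms unfolding left_ideal_def by (blast, blast, blast, blast, metis diff_conv_add_uminus)

context
  fixes mul :: "'a::ab_group_add \<Rightarrow> 'a \<Rightarrow> 'a"
  assumes dist: "left_distributive_ring mul"
begin

lemma mul_0: "mul 0 a = 0" "mul r 0 = 0"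
  using left_distributive_ring_zero[OF dist] .

lemma mul_add: "mul r (a + b) = mul r a + mul r b"
  using dist by (simp add: left_distributive_ring_def)

lemma mul_uminus: "mul r (- a) = - mul r a"
  using mul_add[of r "- a" a] by (simp add: mul_0 eq_neg_iff_add_eq_0)

lemma mul_diff: "mul r (a - b) = mul r a - mul r b"
  using mul_add[of r a "- b"] by (simp add: mul_uminus)

lemma left_span_mult: "a \<in> left_span mul m \<Longrightarrow> mul r a \<in> left_span mul m"
  unfolding left_span_def
proof (induction a rule: int_mod.span_induct)
  let ?U = "\<Union>n\<in>{1..}. left_products mul n m"
  case base
  show "int_mod.subspace {a. mul r a \<in> int_mod.span ?U}"
    by (rule int_subspaceI)
      (auto simp: mul_0 mul_add mul_uminus
        intro: int_mod.span_zero int_mod.span_add int_mod.span_neg)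
next
  let ?U = "\<Union>n\<in>{1..}. left_products mul n m"
  case (step a)
  then obtain rs where rs: "a = foldr mul rs m"
    by (auto simp: left_products_def)
  have "mul r a \<in> left_products mul (length (r # rs)) m"
    unfolding left_products_def rs by (auto intro!: exI[of _ "r # rs"])
  then have "mul r a \<in> ?U" by fastforce
  then show ?case by (rule int_mod.span_base)
qed

lemma mul_in_left_span: "mul r m \<in> left_span mul m"
proof -
  have "mul r m \<in> left_products mul 1 m"
    unfolding left_products_def by (auto intro!: exI[of _ "[r]"])
  then show ?thesis
    unfolding left_span_def by (meson UN_I atLeast_iff int_mod.span_base order_refl)
qed

lemma left_ideal_left_span: "left_ideal mul (left_span mul m)"
  unfolding left_ideal_def
  using left_span_mult
  by (auto simp: left_span_def intro: int_mod.span_zero int_mod.span_add int_mod.span_neg)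

lemma left_ops_diff: "\<phi> \<in> left_ops mul \<Longrightarrow> \<phi> (a - b) = \<phi> a - \<phi> b"
  by (induction arbitrary: a b rule: left_ops.induct) (simp_all add: mul_diff)

lemma left_ops_0: "\<phi> \<in> left_ops mul \<Longrightarrow> \<phi> 0 = 0"
  using left_ops_diff[of \<phi> 0 0] by simp

lemma left_ops_zero: "(\<lambda>a. 0) \<in> left_ops mul"
  using left_ops.diff[OF left_ops.mult left_ops.mult, of mul 0 0] by simp

lemma left_ops_uminus: "\<phi> \<in> left_ops mul \<Longrightarrow> (\<lambda>a. - \<phi> a) \<in> left_ops mul"
  using left_ops.diff[OF left_ops_zero] by simp

lemma left_ops_add:
  "\<phi> \<in> left_ops mul \<Longrightarrow> \<psi> \<in> left_ops mul \<Longrightarrow> (\<lambda>a. \<phi> a + \<psi> a) \<in> left_ops mul"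
  using left_ops.diff[OF _ left_ops_uminus] by fastforce

lemma left_ops_compose:
  "\<phi> \<in> left_ops mul \<Longrightarrow> \<psi> \<in> left_ops mul \<Longrightarrow> (\<lambda>a. \<phi> (\<psi> a)) \<in> left_ops mul"
  by (induction rule: left_ops.induct) (auto intro: left_ops.intros)

lemma foldr_in_left_ops:
  assumes "rs \<noteq> []"
  shows "foldr mul rs \<in> left_ops mul"
  using assms
proof (induction rs)
  case (Cons r rs)
  then show ?case
    using left_ops.mult[of mul r] left_ops.comp[of "foldr mul rs" mul r]
    by (cases "rs = []") (simp_all add: comp_def)
qed simp

text \<open>The values of operators at \<open>m\<close> form a subgroup containing all the products,
  so span induction applies. For \<open>a = m\<close> this gives an operator fixing
  \<open>m\<close>.\<close>

lemma left_span_eq_left_ops: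
  assumes "a \<in> left_span mul m"
  obtains \<phi> where "\<phi> \<in> left_ops mul" "\<phi> m = a"
proof -
  have "\<exists>\<phi>\<in>left_ops mul. \<phi> m = a"
    using assms unfolding left_span_def
  proof (induction a rule: int_mod.span_induct)
    case base
    show "int_mod.subspace {a. \<exists>\<phi>\<in>left_ops mul. \<phi> m = a}"
    proof (rule int_subspaceI; clarsimp)
      show "\<exists>\<phi>\<in>left_ops mul. \<phi> m = 0"
        using left_ops_zero by (rule bexI[rotated]) simp
    next
      fix \<phi> \<psi> assume "\<phi> \<in> left_ops mul" "\<psi> \<in> left_ops mul"
      then show "\<exists>\<chi>\<in>left_ops mul. \<chi> m = \<phi> m + \<psi> m"
        using left_ops_add[of \<phi> \<psi>] by (intro bexI[of _ "\<lambda>a. \<phi> a + \<psi> a"]) auto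
    next
      fix \<phi> assume "\<phi> \<in> left_ops mul"
      then show "\<exists>\<chi>\<in>left_ops mul. \<chi> m = - \<phi> m"
        using left_ops_uminus[of \<phi>] by (intro bexI[of _ "\<lambda>a. - \<phi> a"]) auto
    qed
  next
    case (step a)
    then obtain rs where "a = foldr mul rs m" "1 \<le> length rs"
      by (auto simp: left_products_def)
    moreover from this have "rs \<noteq> []" by auto
    ultimately show ?case
      using foldr_in_left_ops by blast
  qed
  then show ?thesis using that by blast
qed

text \<open>Tominaga's argument: in operator notation, \<open>1 - \<phi> = (1 - \<phi>\<^sub>2) (1 - \<phi>\<^sub>1)\<close>.\<close>

lemma common_local_unit:
  assumes "weakly_left_s_unital mul"
  shows "\<exists>\<phi>\<in>left_ops mul. \<forall>a\<in>set xs. \<phi> a = a"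
\<comment> \<open>Induction on the length, because the hypothesis is applied to the list of errors
  \<open>b - \<phi>1 b\<close> and not to the tail itself.\<close>
proof (induction "length xs" arbitrary: xs)
  case 0
  then show ?case using left_ops_zero by auto
next
  case (Suc n)
  then obtain a ys where xs: "xs = a # ys" "length ys = n"
    by (metis length_Suc_conv)
  obtain \<phi>1 where \<phi>1: "\<phi>1 \<in> left_ops mul" "\<phi>1 a = a"
    using assms left_span_eq_left_ops unfolding weakly_left_s_unital_iff by metis
  have "\<exists>\<phi>2\<in>left_ops mul. \<forall>b\<in>set (map (\<lambda>b. b - \<phi>1 b) ys). \<phi>2 b = b"
    using xs(2) by (intro Suc.hyps) simp
  then obtain \<phi>2 where \<phi>2: "\<phi>2 \<in> left_ops mul" "\<And>b. b \<in> set ys \<Longrightarrow> \<phi>2 (b - \<phi>1 b) = b - \<phi>1 b"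
    by auto
  let ?\<phi> = "\<lambda>b. (\<phi>2 b - \<phi>2 (\<phi>1 b)) + \<phi>1 b"
  have "?\<phi> \<in> left_ops mul"
    by (rule left_ops_add[OF left_ops.diff[OF \<phi>2(1) left_ops_compose[OF \<phi>2(1) \<phi>1(1)]] \<phi>1(1)])
  moreover have "?\<phi> b = b" if "b \<in> set xs" for b
    using that \<phi>1(2) \<phi>2(2) left_ops_diff[OF \<phi>2(1)] by (auto simp: xs)
  ultimately show ?case by (intro bexI[of _ ?\<phi>] ballI)
qed

section \<open>Left ideals of the polynomial ring\<close>

lemma poly_mul_const: "poly_mul mul (monom r 0) f = map_poly (mul r) f"
proof (rule poly_eqI)
  fix n
  have "coeff (poly_mul mul (monom r 0) f) n = (\<Sum>i\<le>n. if i = 0 then mul r (coeff f n) else 0)"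
    unfolding coeff_poly_mul[OF dist] by (intro sum.cong) (auto simp: mul_0)
  then show "coeff (poly_mul mul (monom r 0) f) n = coeff (map_poly (mul r) f) n"
    by (simp add: coeff_map_poly mul_0)
qed

text \<open>The polynomials \<open>r x\<close> belong to \<open>R[x]\<close> even if
  \<open>x\<close> does not; they are the source of all shifts.\<close>

lemma poly_mul_linear: "poly_mul mul (monom r 1) f = pCons 0 (map_poly (mul r) f)"
proof (rule poly_eqI)
  fix n
  have "coeff (poly_mul mul (monom r 1) f) n =
      (\<Sum>i\<le>n. if i = 1 then mul r (coeff f (n - 1)) else 0)"
    unfolding coeff_poly_mul[OF dist] by (intro sum.cong) (auto simp: mul_0)
  then show "coeff (poly_mul mul (monom r 1) f) n = coeff (pCons 0 (map_poly (mul r) f)) n"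
    by (cases n) (auto simp: coeff_map_poly mul_0)
qed

text \<open>The unshifted claim drives the induction: multiplying \<open>map_poly \<phi> f\<close>
  by \<open>r\<close> and by \<open>r x\<close> gives both claims for the composed operator.\<close>

lemma left_ideal_map_poly:
  assumes N: "left_ideal (poly_mul mul) N" and "\<phi> \<in> left_ops mul" "f \<in> N"
  shows "map_poly \<phi> f \<in> N \<and> pCons 0 (map_poly \<phi> f) \<in> N"
  using assms(2)
proof (induction rule: left_ops.induct)
  case (mult r)
  show ?case
    using left_idealD(4)[OF N \<open>f \<in> N\<close>, of "monom r 0"]
      left_idealD(4)[OF N \<open>f \<in> N\<close>, of "monom r 1"]
    unfolding poly_mul_const poly_mul_linear by blast
next
  case (comp \<phi> r)
  have "map_poly (\<lambda>a. mul r (\<phi> a)) f = map_poly (mul r) (map_poly \<phi> f)"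
    using left_ops_0[OF comp.hyps] by (intro poly_eqI) (simp add: coeff_map_poly mul_0)
  then show ?case
    using left_idealD(4)[OF N, of "map_poly \<phi> f" "monom r 0"]
      left_idealD(4)[OF N, of "map_poly \<phi> f" "monom r 1"] comp.IH
    unfolding poly_mul_const poly_mul_linear by simp
next
  case (diff \<phi> \<psi>)
  have "map_poly (\<lambda>a. \<phi> a - \<psi> a) f = map_poly \<phi> f - map_poly \<psi> f"
    using diff.hyps by (intro poly_eqI) (simp add: coeff_map_poly left_ops_0)
  then show ?case
    using diff.IH left_idealD(5)[OF N, of "map_poly \<phi> f" "map_poly \<psi> f"]
      left_idealD(5)[OF N, of "pCons 0 (map_poly \<phi> f)" "pCons 0 (map_poly \<psi> f)"]
    by simp
qed

lemma left_ideal_pCons_0: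
  assumes "weakly_left_s_unital mul" and N: "left_ideal (poly_mul mul) N" and f: "f \<in> N"
  shows "pCons 0 f \<in> N"
proof -
  obtain \<phi> where \<phi>: "\<phi> \<in> left_ops mul" "\<forall>a\<in>set (coeffs f). \<phi> a = a"
    using common_local_unit[OF assms(1)] by blast
  have "map_poly \<phi> f = f"
    using \<phi> by (intro map_poly_idI) auto
  then show ?thesis
    using left_ideal_map_poly[OF N \<phi>(1) f] by simp
qed

section \<open>Necessity: left ideals given by conditions on coefficients\<close>

text \<open>Coefficient \<open>n\<close> of a product is a sum of left multiples of the coefficients
  at \<open>n - i\<close>, so it suffices that left multiplication carries each \<open>J n\<close>
  into all \<open>J (i + n)\<close>.\<close>

lemma left_ideal_coeffs:
  assumes zero: "\<And>n. 0 \<in> J n"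
    and add: "\<And>n a b. a \<in> J n \<Longrightarrow> b \<in> J n \<Longrightarrow> a + b \<in> J n"
    and uminus: "\<And>n a. a \<in> J n \<Longrightarrow> - a \<in> J n"
    and mult: "\<And>i n r a. a \<in> J n \<Longrightarrow> mul r a \<in> J (i + n)"
  shows "left_ideal (poly_mul mul) {f. \<forall>n. coeff f n \<in> J n}"
proof -
  have "coeff (poly_mul mul p q) n \<in> J n" if q: "\<And>n. coeff q n \<in> J n" for p q n
  proof -
    have "sum h A \<in> J n" if "\<And>i. i \<in> A \<Longrightarrow> h i \<in> J n" for h :: "nat \<Rightarrow> 'a" and A
      using that zero add by (induction A rule: infinite_finite_induct) auto
    moreover have "mul (coeff p i) (coeff q (n - i)) \<in> J n" if "i \<le> n" for i
      using mult[OF q, of "coeff p i" "n - i" i] that by simp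
    ultimately show ?thesis
      unfolding coeff_poly_mul[OF dist] by (meson atMost_iff)
  qed
  then show ?thesis
    unfolding left_ideal_def using zero add uminus by auto
qed

text \<open>A left ideal \<open>I\<close> is recovered from the polynomials over \<open>I\<close>
  through their constants, so stabilization descends to \<open>R\<close>.\<close>

lemma left_noetherian_if_poly:
  assumes "left_noetherian (poly_mul mul)"
  shows "left_noetherian mul"
  unfolding left_noetherian_def
proof (intro allI impI)
  fix I :: "nat \<Rightarrow> 'a set"
  assume I: "(\<forall>k. left_ideal mul (I k)) \<and> (\<forall>k. I k \<subseteq> I (Suc k))"
  define P where "P k = {f. \<forall>n. coeff f n \<in> I k}" for k
  have "left_ideal (poly_mul mul) (P k)" for k
    unfolding P_def using I by (intro left_ideal_coeffs) (auto intro: left_idealD)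
  moreover have "P k \<subseteq> P (Suc k)" for k
    using I by (auto simp: P_def)
  ultimately obtain k where k: "\<And>l. l \<ge> k \<Longrightarrow> P l = P k"
    using assms unfolding left_noetherian_def by meson
  have "a \<in> I l \<longleftrightarrow> monom a 0 \<in> P l" for a l
    using I left_idealD(1)[of mul "I l"] by (force simp: P_def)
  then show "\<exists>k. \<forall>l\<ge>k. I l = I k"
    using k by blast
qed

lemma weakly_left_s_unital_if_poly:
  assumes "left_noetherian (poly_mul mul)"
  shows "weakly_left_s_unital mul"
  unfolding weakly_left_s_unital_iff
proof
  fix m
  define A where "A = left_span mul m"
  \<comment> \<open>\<open>B\<close> contains \<open>m\<close> whether or not \<open>A\<close> does,
    and left multiplication sends \<open>B\<close> into \<open>A\<close>, so raising the degree past
    \<open>k\<close> causes no harm in \<open>P k\<close>.\<close>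
  define B where "B = {a. \<forall>r. mul r a \<in> A}"
  define P where "P k = {f. \<forall>n. coeff f n \<in> (if n \<le> k then B else A)}" for k
  have A: "left_ideal mul A"
    unfolding A_def by (rule left_ideal_left_span)
  have "A \<subseteq> B"
    using left_idealD(4)[OF A] by (auto simp: B_def)
  have m: "m \<in> B"
    by (simp add: B_def A_def mul_in_left_span)
  have B: "left_ideal mul B"
    using left_idealD[OF A] unfolding left_ideal_def
    by (auto simp: B_def mul_0 mul_add mul_uminus)
  have "left_ideal (poly_mul mul) (P k)" for k
    unfolding P_def using left_idealD[OF A] left_idealD[OF B] \<open>A \<subseteq> B\<close>
    by (intro left_ideal_coeffs) (auto simp: B_def split: if_splits)
  moreover have "P k \<subseteq> P (Suc k)" for k
    unfolding P_def using \<open>A \<subseteq> B\<close> by (fastforce split: if_splits)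
  ultimately obtain k where k: "\<And>l. l \<ge> k \<Longrightarrow> P l = P k"
    using assms unfolding left_noetherian_def by meson
  \<comment> \<open>Index \<open>k + 1\<close> is the first at which \<open>P k\<close> demands
    \<open>A\<close>, while \<open>P (Suc k)\<close> still demands only \<open>B\<close>
    there.\<close>
  have "monom m (Suc k) \<in> P (Suc k)"
    using m left_idealD(1)[OF A] left_idealD(1)[OF B] by (auto simp: P_def)
  then have "monom m (Suc k) \<in> P k"
    using k[of "Suc k"] by simp
  then have "coeff (monom m (Suc k)) (Suc k) \<in> (if Suc k \<le> k then B else A)"
    unfolding P_def by blast
  then show "m \<in> left_span mul m"
    by (simp add: A_def)
qed

end

section \<open>Sufficiency: leading coefficients and Hilbert's argument\<close>

text \<open>The degree is at most \<open>n\<close> rather than equal to \<open>n\<close>, so that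
  zero is included and cancellation in sums is harmless.\<close>

definition leading_coeffs :: "'a::zero poly set \<Rightarrow> nat \<Rightarrow> 'a set" where
  "leading_coeffs N n = {coeff f n | f. f \<in> N \<and> (\<forall>i>n. coeff f i = 0)}"

lemma leading_coeffs_mono: "N \<subseteq> N' \<Longrightarrow> leading_coeffs N n \<subseteq> leading_coeffs N' n"
  by (auto simp: leading_coeffs_def)

text \<open>Multiplication by \<open>x\<close> moves coefficient \<open>n\<close> to index
  \<open>n + 1\<close>.\<close>

lemma leading_coeffs_Suc_mono:
  assumes "\<And>f. f \<in> N \<Longrightarrow> pCons 0 f \<in> N"
  shows "leading_coeffs N n \<subseteq> leading_coeffs N (Suc n)"
proof
  fix a assume "a \<in> leading_coeffs N n"
  then obtain f where f: "f \<in> N" "\<forall>i>n. coeff f i = 0" "a = coeff f n"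
    by (auto simp: leading_coeffs_def)
  have "\<forall>i>Suc n. coeff (pCons 0 f) i = 0"
    using f(2) by (auto simp: coeff_pCons split: nat.splits)
  then show "a \<in> leading_coeffs N (Suc n)"
    unfolding leading_coeffs_def using f assms by (auto intro!: exI[of _ "pCons 0 f"])
qed

lemma left_ideal_leading_coeffs:
  assumes dist: "left_distributive_ring mul" and N: "left_ideal (poly_mul mul) N"
  shows "left_ideal mul (leading_coeffs N n)"
  unfolding left_ideal_def
proof (intro conjI ballI allI)
  show "0 \<in> leading_coeffs N n"
    unfolding leading_coeffs_def using left_idealD(1)[OF N] by (auto intro!: exI[of _ 0])
next
  fix a b assume "a \<in> leading_coeffs N n" "b \<in> leading_coeffs N n"
  then obtain f g where "f \<in> N" "\<forall>i>n. coeff f i = 0" "a = coeff f n"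
    "g \<in> N" "\<forall>i>n. coeff g i = 0" "b = coeff g n"
    by (auto simp: leading_coeffs_def)
  then show "a + b \<in> leading_coeffs N n"
    unfolding leading_coeffs_def using left_idealD(2)[OF N] by (auto intro!: exI[of _ "f + g"])
next
  fix a assume "a \<in> leading_coeffs N n"
  then obtain f where "f \<in> N" "\<forall>i>n. coeff f i = 0" "a = coeff f n"
    by (auto simp: leading_coeffs_def)
  then show "- a \<in> leading_coeffs N n"
    unfolding leading_coeffs_def using left_idealD(3)[OF N] by (auto intro!: exI[of _ "- f"])
next
  fix r a assume "a \<in> leading_coeffs N n"
  then obtain f where "f \<in> N" "\<forall>i>n. coeff f i = 0" "a = coeff f n"
    by (auto simp: leading_coeffs_def)
  moreover from this have "map_poly (mul r) f \<in> N"
    using left_idealD(4)[OF N, of f "monom r 0"] by (simp add: poly_mul_const[OF dist])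
  ultimately show "mul r a \<in> leading_coeffs N n"
    unfolding leading_coeffs_def
    by (auto intro!: exI[of _ "map_poly (mul r) f"] simp: coeff_map_poly mul_0[OF dist])
qed

text \<open>Descent on the degree: subtracting some \<open>g \<in> N\<close> with the same top
  coefficient leaves an element of \<open>N'\<close> with a smaller degree bound.\<close>

lemma left_ideal_eq_if_leading_coeffs_eq:
  assumes N: "left_ideal (poly_mul mul) N" and N': "left_ideal (poly_mul mul) N'"
    and "N \<subseteq> N'" and eq: "\<And>n. leading_coeffs N n = leading_coeffs N' n"
  shows "N = N'"
proof -
  \<comment> \<open>The bound \<open>d\<close> is strict, so \<open>d = 0\<close> is the case of the
    zero polynomial.\<close>
  have "f \<in> N" if "f \<in> N'" "\<forall>i\<ge>d. coeff f i = 0" for f d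
    using that
  proof (induction d arbitrary: f)
    case 0
    then have "f = 0" by (intro poly_eqI) simp
    then show ?case using left_idealD(1)[OF N] by simp
  next
    case (Suc d)
    then have "coeff f d \<in> leading_coeffs N' d"
      by (auto simp: leading_coeffs_def)
    then obtain g where g: "g \<in> N" "\<forall>i>d. coeff g i = 0" "coeff g d = coeff f d"
      unfolding eq[symmetric] by (auto simp: leading_coeffs_def)
    have "coeff (f - g) i = 0" if "i \<ge> d" for i
      using Suc.prems(2) g that by (cases "i = d") auto
    moreover have "f - g \<in> N'"
      using Suc.prems(1) g(1) \<open>N \<subseteq> N'\<close> left_idealD(5)[OF N'] by blast
    ultimately have "f - g \<in> N" using Suc.IH[of "f - g"] by blast
    then show ?case
      using left_idealD(2)[OF N _ g(1)] by (metis diff_add_cancel)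
  qed
  then have "f \<in> N" if "f \<in> N'" for f
    using that by (metis MOST_nat_le coeff_eq_0 less_eq_Suc_le)
  then show ?thesis using \<open>N \<subseteq> N'\<close> by blast
qed

text \<open>Once the diagonal is stable from \<open>D\<close> on, all \<open>n \<ge> D\<close> are
  settled uniformly; the finitely many smaller \<open>n\<close> stabilize separately, and a maximum
  is taken.\<close>

lemma left_noetherian_double_chain:
  fixes I :: "nat \<Rightarrow> nat \<Rightarrow> 'a::ab_group_add set"
  assumes noeth: "left_noetherian mul" and ideal: "\<And>k n. left_ideal mul (I k n)"
    and Suc1: "\<And>k n. I k n \<subseteq> I (Suc k) n" and Suc2: "\<And>k n. I k n \<subseteq> I k (Suc n)"
  shows "\<exists>K. \<forall>k\<ge>K. \<forall>n. I k n = I K n"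
proof -
  have mono: "I k n \<subseteq> I k' n'" if "k \<le> k'" "n \<le> n'" for k k' n n'
    using lift_Suc_mono_le[of "\<lambda>k. I k n", OF Suc1 that(1)]
      lift_Suc_mono_le[of "I k'", OF Suc2 that(2)] by blast
  have "\<exists>K. \<forall>k\<ge>K. I k k = I K K"
    using noeth ideal mono[OF le_SucI[OF order_refl] le_SucI[OF order_refl]]
    unfolding left_noetherian_def by (elim allE[of _ "\<lambda>k. I k k"]) blast
  then obtain D where D: "\<And>k. k \<ge> D \<Longrightarrow> I k k = I D D" by blast
  have "\<exists>K. \<forall>k\<ge>K. I k n = I K n" for n
    using noeth ideal Suc1 unfolding left_noetherian_def
    by (elim allE[of _ "\<lambda>k. I k n"]) blast
  then obtain K where K: "\<And>n k. k \<ge> K n \<Longrightarrow> I k n = I (K n) n" by metis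
  define M where "M = Max (insert D (K ` {..<D}))"
  have M: "D \<le> M" "\<And>n. n < D \<Longrightarrow> K n \<le> M"
    by (simp_all add: M_def)
  have "I k n = I M n" if "k \<ge> M" for k n
  proof (cases "n < D")
    case True
    then show ?thesis using K M(2) that by (metis order_trans)
  next
    case False
    \<comment> \<open>\<open>I j n\<close> is squeezed between \<open>I D D\<close> and the diagonal
      member at \<open>max j n\<close>, which equals \<open>I D D\<close>.\<close>
    have "I j n = I D D" if "j \<ge> D" for j
      using mono[of D j D n] mono[of j "max j n" n "max j n"] D[of "max j n"] that False by auto
    then show ?thesis using M(1) that by simp
  qed
  then show ?thesis by blast
qed

text \<open>The sets \<open>leading_coeffs (N k) n\<close> grow in \<open>k\<close> with the chain
  and in \<open>n\<close> by closure under \<open>x\<close>. A single \<open>K\<close> serving all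
  \<open>n\<close> is what the comparison of \<open>N K\<close> with \<open>N k\<close>
  requires.\<close>

lemma left_noetherian_poly:
  fixes mul :: "'a::ab_group_add \<Rightarrow> 'a \<Rightarrow> 'a"
  assumes dist: "left_distributive_ring mul" and "left_noetherian mul"
    and unit: "weakly_left_s_unital mul"
  shows "left_noetherian (poly_mul mul)"
  unfolding left_noetherian_def
proof (intro allI impI)
  fix N :: "nat \<Rightarrow> 'a poly set"
  assume N: "(\<forall>k. left_ideal (poly_mul mul) (N k)) \<and> (\<forall>k. N k \<subseteq> N (Suc k))"
  have "\<exists>K. \<forall>k\<ge>K. \<forall>n. leading_coeffs (N k) n = leading_coeffs (N K) n"
    using N left_ideal_pCons_0[OF dist unit]
    by (intro left_noetherian_double_chain[OF \<open>left_noetherian mul\<close>] leading_coeffs_mono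
        leading_coeffs_Suc_mono left_ideal_leading_coeffs[OF dist]) auto
  then obtain K where K: "\<And>k n. k \<ge> K \<Longrightarrow> leading_coeffs (N k) n = leading_coeffs (N K) n"
    by blast
  have "N K = N k" if "k \<ge> K" for k
  proof (rule left_ideal_eq_if_leading_coeffs_eq)
    show "N K \<subseteq> N k"
      using N lift_Suc_mono_le[of N, OF _ that] by blast
  qed (use N K[OF that] in auto)
  then show "\<exists>k. \<forall>l\<ge>k. N l = N k" by metis
qed

theorem corollary50:
  fixes mul :: "'a::ab_group_add \<Rightarrow> 'a \<Rightarrow> 'a"
  assumes "left_distributive_ring mul"
  shows "(left_noetherian (poly_mul mul) \<longleftrightarrow> left_noetherian mul \<and> weakly_left_s_unital mul)
    \<and> (unital mul \<longrightarrow> (left_noetherian (poly_mul mul) \<longleftrightarrow> left_noetherian mul))"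
  using left_noetherian_if_poly[OF assms] weakly_left_s_unital_if_poly[OF assms]
    left_noetherian_poly[OF assms] unital_imp_weakly_left_s_unital[of mul]
  by blast

end
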